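(* Let $T$ be an embedding tensor on a $3$-Lie algebra $(\mathfrak g,[\cdot,\cdot,\cdot]_{\mathfrak g})$ with respect to a representation $(V;\rho)$, and let $T_t=\sum_{i\ge0}\tau_it^i$ and $\tilde T_t=\sum_{i\ge0}\tilde\tau_it^i$ be two equivalent formal deformations of $T$. Then their infinitesimals $\tau_1$ and $\tilde\tau_1$ are in the same cohomology class in $\mathcal H^2(T)$.
   Context: All vector spaces are over an algebraically closed field $\mathbb K$ of characteristic $0$. A $3$-Lie algebra is a vector space $\mathfrak g$ with a skew-symmetric trilinear bracket $[\cdot,\cdot,\cdot]_{\mathfrak g}$ such that $[x_1,x_2,[x_3,x_4,x_5]_{\mathfrak g}]_{\mathfrak g}=[[x_1,x_2,x_3]_{\mathfrak g},x_4,x_5]_{\mathfrak g}+[x_3,[x_1,x_2,x_4]_{\mathfrak g},x_5]_{\mathfrak g}+[x_3,x_4,[x_1,x_2,x_5]_{\mathfrak g}]_{\mathfrak g}$ for all $x_i\in\mathfrak g$. A representation of $\mathfrak g$ on a vector space $V$ is a linear map $\rho:\wedge^2\mathfrak g\to\mathfrak{gl}(V)$ such that for all $x_i\in\mathfrak g$: $\rho(x_1,x_2)\rho(x_3,x_4)=\rho([x_1,x_2,x_3]_{\mathfrak g},x_4)+\rho(x_3,[x_1,x_2,x_4]_{\mathfrak g})+\rho(x_3,x_4)\rho(x_1,x_2)$ and $\rho(x_1,[x_2,x_3,x_4]_{\mathfrak g})=\rho(x_3,x_4)\rho(x_1,x_2)-\rho(x_2,x_4)\rho(x_1,x_3)+\rho(x_2,x_3)\rho(x_1,x_4)$.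 An embedding tensor on $\mathfrak g$ with respect to $(V;\rho)$ is a linear map $T:V\to\mathfrak g$ with $[Tu,Tv,Tw]_{\mathfrak g}=T(\rho(Tu,Tv)w)$ for all $u,v,w\in V$. Cohomology of $T$. Put $[u,v,w]_T=\rho(Tu,Tv)w$, $l_T(u,v)(x)=[Tu,Tv,x]_{\mathfrak g}$, $m_T(u,v)(x)=[Tu,x,Tv]_{\mathfrak g}-T(\rho(Tu,x)v)$, $r_T=-m_T$; for $U=u\otimes v$ write $[U,w]_T=[u,v,w]_T$, $l_T(U)=l_T(u,v)$. For $n\ge1$ let $\mathfrak C^n_{\mathsf{3Leib}}(V;\mathfrak g)=\mathrm{Hom}((\otimes^2V)^{\otimes(n-1)}\otimes V,\mathfrak g)$ and let $\partial_T:\mathfrak C^n_{\mathsf{3Leib}}(V;\mathfrak g)\to\mathfrak C^{n+1}_{\mathsf{3Leib}}(V;\mathfrak g)$ be, for $U_i=u_i\otimes v_i$, $w\in V$, $(\partial_T\theta)(U_1,\dots,U_n,w)=\sum_{1\le j<k\le n}(-1)^j\theta(U_1,\dots,\hat U_j,\dots,U_{k-1},[u_j,v_j,u_k]_T\otimes v_k,U_{k+1},\dots,U_n,w)$ $+\sum_{1\le j<k\le n}(-1)^j\theta(U_1,\dots,\hat U_j,\dots,U_{k-1},u_k\otimes[u_j,v_j,v_k]_T,U_{k+1},\dots,U_n,w)$ $+\sum_{j=1}^n\big((-1)^j\theta(U_1,\dots,\hat U_j,\dots,U_n,[U_j,w]_T)+(-1)^{j+1}l_T(U_j)\theta(U_1,\dots,\hat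 U_j,\dots,U_n,w)\big)$ $+(-1)^{n+1}\big(m_T(u_n,w)\theta(U_1,\dots,U_{n-1},v_n)+r_T(v_n,w)\theta(U_1,\dots,U_{n-1},u_n)\big)$. For $\mathfrak X\in\mathfrak g\wedge\mathfrak g$ let $\delta(\mathfrak X)v=T\rho(\mathfrak X)v-[\mathfrak X,Tv]_{\mathfrak g}$, where $[x\wedge y,z]_{\mathfrak g}=[x,y,z]_{\mathfrak g}$ (extended linearly). Set $\mathfrak C_T^1(V;\mathfrak g)=\mathfrak g\wedge\mathfrak g$, $\mathfrak C_T^k(V;\mathfrak g)=\mathfrak C^{k-1}_{\mathsf{3Leib}}(V;\mathfrak g)$ for $k\ge2$; $\mathrm d^{\mathsf T}$ equals $\delta$ on $\mathfrak C_T^1$ and $\partial_T$ on $\mathfrak C_T^k$, $k\ge2$. This is a cochain complex; $\mathcal Z^k(T)$ and $\mathcal B^k(T)$ are its $k$-cocycles and $k$-coboundaries and $\mathcal H^k(T)=\mathcal Z^k(T)/\mathcal B^k(T)$. Formal deformations. The bracket of $\mathfrak g$ and the action $\rho$ are extended $\mathbb K[[t]]$-multilinearly to $\mathfrak g[[t]]$ and $V[[t]]$ (formal power series with coefficients in $\mathfrak g$, $V$). A formal deformation of $T$ is a power series $T_t=\sum_{i\ge0}\tau_it^i$ with $\tau_i\in\mathrm{Hom}_{\mathbb K}(V,\mathfrak g)$ and $\tau_0=T$, extended to a $\mathbb K[[t]]$-module map $V[[t]]\to\mathfrak g[[t]]$, such that $[T_tu,T_tv,T_tw]_{\mathfrak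 g}=T_t(\rho(T_tu,T_tv)w)$ for all $u,v,w\in V$. Its infinitesimal is $\tau_1$, which is a $2$-cocycle ($\mathrm d^{\mathsf T}\tau_1=0$). Two formal deformations $T_t$ and $\tilde T_t$ of $T=\tau_0=\tilde\tau_0$ are equivalent if there exist $\mathfrak X\in\wedge^2\mathfrak g$, $\phi_i\in\mathfrak{gl}(\mathfrak g)$, $\psi_i\in\mathfrak{gl}(V)$, $i\ge2$, such that for $\phi_t=\mathrm{Id}_{\mathfrak g}+t\,\mathrm{ad}_{\mathfrak X}+\sum_{i\ge2}t^i\phi_i$ and $\psi_t=\mathrm{Id}_V+t\rho(\mathfrak X)+\sum_{i\ge2}t^i\psi_i$ one has: $\phi_t([x,y,z]_{\mathfrak g})=[\phi_t(x),\phi_t(y),\phi_t(z)]_{\mathfrak g}$ for all $x,y,z\in\mathfrak g$; $\rho(\phi_t(x),\phi_t(y))\psi_t(u)=\psi_t(\rho(x,y)u)$ for all $x,y\in\mathfrak g$, $u\in V$; and $T_t\circ\psi_t=\phi_t\circ\tilde T_t$. Here $\mathrm{ad}_{\mathfrak X}z=[\mathfrak X,z]_{\mathfrak g}$. *)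

theory Defs
  imports "HOL-Library.Poly_Mapping" "HOL-Computational_Algebra.Computational_Algebra"
begin

section \<open>3-Lie algebras, representations, embedding tensors\<close>

locale three_Lie_algebra = vector_space sg
  for sg :: "'k::{alg_closed_field, field_char_0} \<Rightarrow> 'g::ab_group_add \<Rightarrow> 'g" +
  fixes br :: "'g \<Rightarrow> 'g \<Rightarrow> 'g \<Rightarrow> 'g"
  assumes br_linear1: "Vector_Spaces.linear sg sg (\<lambda>x. br x y z)"
    and br_linear2: "Vector_Spaces.linear sg sg (\<lambda>y. br x y z)"
    and br_linear3: "Vector_Spaces.linear sg sg (\<lambda>z. br x y z)"
    and br_skew12: "br y x z = - br x y z"
    and br_skew23: "br x z y = - br x y z"
    and br_fundamental: "br x1 x2 (br x3 x4 x5) =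
        br (br x1 x2 x3) x4 x5 + br x3 (br x1 x2 x4) x5 + br x3 x4 (br x1 x2 x5)"

text \<open>A linear map out of the exterior square into \<open>gl(V)\<close> is given as an alternating bilinear map;
  \<open>ext2_lift\<close> below recovers its value on arbitrary elements of the exterior square.\<close>

locale three_Lie_representation = three_Lie_algebra sg br + V: vector_space sv
  for sg :: "'k::{alg_closed_field, field_char_0} \<Rightarrow> 'g::ab_group_add \<Rightarrow> 'g"
    and br :: "'g \<Rightarrow> 'g \<Rightarrow> 'g \<Rightarrow> 'g"
    and sv :: "'k \<Rightarrow> 'v::ab_group_add \<Rightarrow> 'v" +
  fixes \<rho> :: "'g \<Rightarrow> 'g \<Rightarrow> 'v \<Rightarrow> 'v"
  assumes rho_gl: "Vector_Spaces.linear sv sv (\<rho> x y)"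
    and rho_linear1: "Vector_Spaces.linear sg sv (\<lambda>x. \<rho> x y v)"
    and rho_linear2: "Vector_Spaces.linear sg sv (\<lambda>y. \<rho> x y v)"
    and rho_alternating: "\<rho> x x v = 0"
    and rho_comp: "\<rho> x1 x2 (\<rho> x3 x4 v) =
        \<rho> (br x1 x2 x3) x4 v + \<rho> x3 (br x1 x2 x4) v + \<rho> x3 x4 (\<rho> x1 x2 v)"
    and rho_br: "\<rho> x1 (br x2 x3 x4) v =
        \<rho> x3 x4 (\<rho> x1 x2 v) - \<rho> x2 x4 (\<rho> x1 x3 v) + \<rho> x2 x3 (\<rho> x1 x4 v)"

locale embedding_tensor = three_Lie_representation sg br sv \<rho>
  for sg :: "'k::{alg_closed_field, field_char_0} \<Rightarrow> 'g::ab_group_add \<Rightarrow> 'g"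
    and br :: "'g \<Rightarrow> 'g \<Rightarrow> 'g \<Rightarrow> 'g"
    and sv :: "'k \<Rightarrow> 'v::ab_group_add \<Rightarrow> 'v"
    and \<rho> :: "'g \<Rightarrow> 'g \<Rightarrow> 'v \<Rightarrow> 'v" +
  fixes T :: "'v \<Rightarrow> 'g"
  assumes T_linear: "Vector_Spaces.linear sv sg T"
    and T_embedding: "br (T u) (T v) (T w) = T (\<rho> (T u) (T v) w)"

section \<open>The exterior square\<close>

text \<open>The exterior square of \<open>'g\<close> is the free vector space on \<open>'g \<times> 'g\<close> modulo the usual relators;
  its elements are cosets.\<close>

definition free_scale :: "'k::field \<Rightarrow> ('b \<Rightarrow>\<^sub>0 'k) \<Rightarrow> ('b \<Rightarrow>\<^sub>0 'k)" where
  "free_scale c p = Poly_Mapping.map (\<lambda>a. c * a) p"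

definition wedge_relators ::
    "('k::field \<Rightarrow> 'g::ab_group_add \<Rightarrow> 'g) \<Rightarrow> ('g \<times> 'g \<Rightarrow>\<^sub>0 'k) set" where
  "wedge_relators sg =
     {Poly_Mapping.single (x + x', y) 1 - Poly_Mapping.single (x, y) 1
        - Poly_Mapping.single (x', y) 1 | x x' y. True} \<union>
     {Poly_Mapping.single (x, y + y') 1 - Poly_Mapping.single (x, y) 1
        - Poly_Mapping.single (x, y') 1 | x y y'. True} \<union>
     {Poly_Mapping.single (sg c x, y) 1 - Poly_Mapping.single (x, y) c | c x y. True} \<union>
     {Poly_Mapping.single (x, sg c y) 1 - Poly_Mapping.single (x, y) c | c x y. True} \<union>
     {Poly_Mapping.single (x, x) 1 | x. True}"

definition wedge_rel ::
    "('k::field \<Rightarrow> 'g::ab_group_add \<Rightarrow> 'g) \<Rightarrow> (('g \<times> 'g \<Rightarrow>\<^sub>0 'k) \<times> ('g \<times> 'g \<Rightarrow>\<^sub>0 'k)) set" where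
  "wedge_rel sg = {(p, q). p - q \<in> module.span free_scale (wedge_relators sg)}"

definition ext2 :: "('k::field \<Rightarrow> 'g::ab_group_add \<Rightarrow> 'g) \<Rightarrow> ('g \<times> 'g \<Rightarrow>\<^sub>0 'k) set set" where
  "ext2 sg = UNIV // wedge_rel sg"

definition wedge ::
    "('k::field \<Rightarrow> 'g::ab_group_add \<Rightarrow> 'g) \<Rightarrow> 'g \<Rightarrow> 'g \<Rightarrow> ('g \<times> 'g \<Rightarrow>\<^sub>0 'k) set" where
  "wedge sg x y = wedge_rel sg `` {Poly_Mapping.single (x, y) 1}"

definition free_lift ::
    "('k::field \<Rightarrow> 'w::ab_group_add \<Rightarrow> 'w) \<Rightarrow> ('g \<Rightarrow> 'g \<Rightarrow> 'w) \<Rightarrow> ('g \<times> 'g \<Rightarrow>\<^sub>0 'k) \<Rightarrow> 'w" where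
  "free_lift sw f p =
     (\<Sum>q\<in>Poly_Mapping.keys p. sw (Poly_Mapping.lookup p q) (f (fst q) (snd q)))"

text \<open>The linear map on the exterior square induced by an alternating bilinear map \<open>f\<close>; it is
  well defined by \<open>ext2_lift_class\<close> below.\<close>

definition ext2_lift ::
    "('k::field \<Rightarrow> 'w::ab_group_add \<Rightarrow> 'w) \<Rightarrow> ('g \<Rightarrow> 'g \<Rightarrow> 'w) \<Rightarrow> ('g \<times> 'g \<Rightarrow>\<^sub>0 'k) set \<Rightarrow> 'w" where
  "ext2_lift sw f X = the_elem (free_lift sw f ` X)"

lemma lookup_free_scale [simp]:
  "Poly_Mapping.lookup (free_scale c p) q = c * Poly_Mapping.lookup p q"
  unfolding free_scale_def by (simp add: Poly_Mapping.map.rep_eq when_def)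

lemma vector_space_free_scale: "vector_space free_scale"
  by unfold_locales (auto intro!: poly_mapping_eqI simp: lookup_add algebra_simps)

lemma free_lift_superset:
  assumes "vector_space sw" "finite A" "Poly_Mapping.keys p \<subseteq> A"
  shows "free_lift sw f p = (\<Sum>q\<in>A. sw (Poly_Mapping.lookup p q) (f (fst q) (snd q)))"
proof -
  interpret vector_space sw by fact
  show ?thesis unfolding free_lift_def
    by (rule sum.mono_neutral_left) (use assms in \<open>auto simp: in_keys_iff\<close>)
qed

lemma linear_free_lift:
  assumes "vector_space sw"
  shows "Vector_Spaces.linear free_scale sw (free_lift sw f)"
proof -
  interpret W: vector_space sw by fact
  interpret F: vector_space "free_scale :: 'a \<Rightarrow> ('c \<times> 'c \<Rightarrow>\<^sub>0 'a) \<Rightarrow> _"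
    by (rule vector_space_free_scale)
  show ?thesis
  proof unfold_locales
    fix p q :: "'c \<times> 'c \<Rightarrow>\<^sub>0 'a"
    let ?A = "Poly_Mapping.keys p \<union> Poly_Mapping.keys q"
    have "Poly_Mapping.keys (p + q) \<subseteq> ?A" by (rule keys_add)
    then show "free_lift sw f (p + q) = free_lift sw f p + free_lift sw f q"
      by (simp add: free_lift_superset[OF assms, of ?A] lookup_add W.scale_left_distrib sum.distrib)
  next
    fix c and p :: "'c \<times> 'c \<Rightarrow>\<^sub>0 'a"
    have "Poly_Mapping.keys (free_scale c p) \<subseteq> Poly_Mapping.keys p"
      by (auto simp: in_keys_iff)
    then show "free_lift sw f (free_scale c p) = sw c (free_lift sw f p)"
      by (simp add: free_lift_superset[OF assms, of "Poly_Mapping.keys p"] W.scale_sum_right)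
  qed
qed

lemma free_lift_single:
  assumes "vector_space sw"
  shows "free_lift sw f (Poly_Mapping.single (x, y) c) = sw c (f x y)"
proof -
  interpret W: vector_space sw by fact
  show ?thesis by (simp add: free_lift_def)
qed

lemma ext2_lift_class:
  fixes sg :: "'k::field \<Rightarrow> 'g::ab_group_add \<Rightarrow> 'g" and sw :: "'k \<Rightarrow> 'w::ab_group_add \<Rightarrow> 'w"
    and f :: "'g \<Rightarrow> 'g \<Rightarrow> 'w"
  assumes lin1: "\<And>y. Vector_Spaces.linear sg sw (\<lambda>x. f x y)"
    and lin2: "\<And>x. Vector_Spaces.linear sg sw (\<lambda>y. f x y)"
    and alt: "\<And>x. f x x = 0"
  shows "ext2_lift sw f (wedge_rel sg `` {p}) = free_lift sw f p"
proof -
  have W: "vector_space sw" using lin1 by (simp add: Vector_Spaces.linear_def)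
  interpret W: vector_space sw by (rule W)
  interpret F: vector_space "free_scale :: 'k \<Rightarrow> ('g \<times> 'g \<Rightarrow>\<^sub>0 'k) \<Rightarrow> _"
    by (rule vector_space_free_scale)
  interpret L: Vector_Spaces.linear free_scale sw "free_lift sw f" by (rule linear_free_lift[OF W])
  interpret l1: Vector_Spaces.linear sg sw "\<lambda>x. f x y" for y by (rule lin1)
  interpret l2: Vector_Spaces.linear sg sw "\<lambda>y. f x y" for x by (rule lin2)
  have gen: "free_lift sw f r = 0" if "r \<in> wedge_relators sg" for r
    using that unfolding wedge_relators_def
    by (auto simp: L.diff free_lift_single[OF W] l1.add l2.add l1.scale l2.scale alt)
  have "free_lift sw f r = 0" if "r \<in> F.span (wedge_relators sg)" for r
    using that by (induction rule: F.span_induct_alt) (simp_all add: L.add L.scale gen L.zero)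
  then have "free_lift sw f q = free_lift sw f p" if "(p, q) \<in> wedge_rel sg" for q
    using that L.diff[of p q] by (simp add: wedge_rel_def)
  moreover have "(p, p) \<in> wedge_rel sg" by (simp add: wedge_rel_def F.span_zero)
  ultimately have "free_lift sw f ` (wedge_rel sg `` {p}) = {free_lift sw f p}"
    by (intro subset_antisym subsetI) (blast, blast)
  then show ?thesis by (simp add: ext2_lift_def)
qed

lemma ext2_lift_wedge:
  fixes sg :: "'k::field \<Rightarrow> 'g::ab_group_add \<Rightarrow> 'g" and sw :: "'k \<Rightarrow> 'w::ab_group_add \<Rightarrow> 'w"
    and f :: "'g \<Rightarrow> 'g \<Rightarrow> 'w"
  assumes "\<And>y. Vector_Spaces.linear sg sw (\<lambda>x. f x y)"
    and "\<And>x. Vector_Spaces.linear sg sw (\<lambda>y. f x y)"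
    and "\<And>x. f x x = 0"
  shows "ext2_lift sw f (wedge sg x y) = f x y"
proof -
  have W: "vector_space sw" using assms(1) by (simp add: Vector_Spaces.linear_def)
  then interpret W: vector_space sw .
  show ?thesis
    unfolding wedge_def by (subst ext2_lift_class) (use assms in \<open>simp_all add: free_lift_single[OF W]\<close>)
qed

definition ad2 ::
    "('k::field \<Rightarrow> 'g::ab_group_add \<Rightarrow> 'g) \<Rightarrow> ('g \<Rightarrow> 'g \<Rightarrow> 'g \<Rightarrow> 'g) \<Rightarrow>
     ('g \<times> 'g \<Rightarrow>\<^sub>0 'k) set \<Rightarrow> 'g \<Rightarrow> 'g" where
  "ad2 sg br X z = ext2_lift sg (\<lambda>x y. br x y z) X"

definition rho2 ::
    "('k::field \<Rightarrow> 'v::ab_group_add \<Rightarrow> 'v) \<Rightarrow> ('g \<Rightarrow> 'g \<Rightarrow> 'v \<Rightarrow> 'v) \<Rightarrow>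
     ('g \<times> 'g \<Rightarrow>\<^sub>0 'k) set \<Rightarrow> 'v \<Rightarrow> 'v" where
  "rho2 sv \<rho> X v = ext2_lift sv (\<lambda>x y. \<rho> x y v) X"

section \<open>Cohomology of an embedding tensor\<close>

definition bracket_T :: "('g \<Rightarrow> 'g \<Rightarrow> 'v \<Rightarrow> 'v) \<Rightarrow> ('v \<Rightarrow> 'g) \<Rightarrow> 'v \<Rightarrow> 'v \<Rightarrow> 'v \<Rightarrow> 'v" where
  "bracket_T \<rho> T u v w = \<rho> (T u) (T v) w"

definition l_T :: "('g \<Rightarrow> 'g \<Rightarrow> 'g \<Rightarrow> 'g) \<Rightarrow> ('v \<Rightarrow> 'g) \<Rightarrow> 'v \<Rightarrow> 'v \<Rightarrow> 'g \<Rightarrow> 'g" where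
  "l_T br T u v x = br (T u) (T v) x"

definition m_T ::
    "('g \<Rightarrow> 'g \<Rightarrow> 'g \<Rightarrow> 'g::ab_group_add) \<Rightarrow> ('g \<Rightarrow> 'g \<Rightarrow> 'v \<Rightarrow> 'v) \<Rightarrow> ('v \<Rightarrow> 'g) \<Rightarrow> 'v \<Rightarrow> 'v \<Rightarrow> 'g \<Rightarrow> 'g" where
  "m_T br \<rho> T u v x = br (T u) x (T v) - T (\<rho> (T u) x v)"

definition r_T ::
    "('g \<Rightarrow> 'g \<Rightarrow> 'g \<Rightarrow> 'g::ab_group_add) \<Rightarrow> ('g \<Rightarrow> 'g \<Rightarrow> 'v \<Rightarrow> 'v) \<Rightarrow> ('v \<Rightarrow> 'g) \<Rightarrow> 'v \<Rightarrow> 'v \<Rightarrow> 'g \<Rightarrow> 'g" where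
  "r_T br \<rho> T u v x = - m_T br \<rho> T u v x"

text \<open>A linear map from the tensor product of \<open>n - 1\<close> copies of \<open>V \<otimes> V\<close> and one of \<open>V\<close> to
  \<open>g\<close> is represented by the corresponding multilinear map, taking the list of pairs \<open>(u\<^sub>i, v\<^sub>i)\<close>, of length \<open>n - 1\<close>, for \<open>U\<^sub>i = u\<^sub>i \<otimes> v\<^sub>i\<close>, and the last
  argument. On lists of any other length it is zero, so that equality of cochains is equality of
  functions.\<close>

type_synonym ('v, 'g) cochain = "('v \<times> 'v) list \<Rightarrow> 'v \<Rightarrow> 'g"

definition leib_cochains ::
    "('k::field \<Rightarrow> 'v::ab_group_add \<Rightarrow> 'v) \<Rightarrow> ('k \<Rightarrow> 'g::ab_group_add \<Rightarrow> 'g) \<Rightarrow> nat \<Rightarrow>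
     ('v, 'g) cochain set" where
  "leib_cochains sv sg n = {\<theta>.
     (\<forall>Us w. length Us \<noteq> n - 1 \<longrightarrow> \<theta> Us w = 0) \<and>
     (\<forall>Us. length Us = n - 1 \<longrightarrow> Vector_Spaces.linear sv sg (\<theta> Us)) \<and>
     (\<forall>Us i v w. length Us = n - 1 \<longrightarrow> i < n - 1 \<longrightarrow>
        Vector_Spaces.linear sv sg (\<lambda>u. \<theta> (Us[i := (u, v)]) w)) \<and>
     (\<forall>Us i u w. length Us = n - 1 \<longrightarrow> i < n - 1 \<longrightarrow>
        Vector_Spaces.linear sv sg (\<lambda>v. \<theta> (Us[i := (u, v)]) w))}"

text \<open>\<open>Hom(V, g)\<close> as cochains with \<open>n = 1\<close>.\<close>

definition hom_cochain :: "('v \<Rightarrow> 'g::zero) \<Rightarrow> ('v, 'g) cochain" where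
  "hom_cochain \<tau> = (\<lambda>Us w. if Us = [] then \<tau> w else 0)"

text \<open>Positions are counted from 1, as in the formula for the coboundary.\<close>

definition omit :: "nat \<Rightarrow> 'a list \<Rightarrow> 'a list" where
  "omit j xs = take (j - 1) xs @ drop j xs"

definition put :: "nat \<Rightarrow> 'a \<Rightarrow> 'a list \<Rightarrow> 'a list" where
  "put k a xs = xs[k - 1 := a]"

definition partial_T ::
    "('k::field \<Rightarrow> 'g::ab_group_add \<Rightarrow> 'g) \<Rightarrow> ('g \<Rightarrow> 'g \<Rightarrow> 'g \<Rightarrow> 'g) \<Rightarrow>
     ('g \<Rightarrow> 'g \<Rightarrow> 'v::ab_group_add \<Rightarrow> 'v) \<Rightarrow> ('v \<Rightarrow> 'g) \<Rightarrow> nat \<Rightarrow> ('v, 'g) cochain \<Rightarrow> ('v, 'g) cochain" where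
  "partial_T sg br \<rho> T n \<theta> = (\<lambda>Us w.
     if length Us \<noteq> n then 0
     else
       let u = (\<lambda>j. fst (Us ! (j - 1))); v = (\<lambda>j. snd (Us ! (j - 1))) in
         (\<Sum>k = 1..n. \<Sum>j = 1..<k. sg ((- 1) ^ j)
            (\<theta> (omit j (put k (bracket_T \<rho> T (u j) (v j) (u k), v k) Us)) w))
       + (\<Sum>k = 1..n. \<Sum>j = 1..<k. sg ((- 1) ^ j)
            (\<theta> (omit j (put k (u k, bracket_T \<rho> T (u j) (v j) (v k)) Us)) w))
       + (\<Sum>j = 1..n.
            sg ((- 1) ^ j) (\<theta> (omit j Us) (bracket_T \<rho> T (u j) (v j) w))
            + sg ((- 1) ^ (j + 1)) (l_T br T (u j) (v j) (\<theta> (omit j Us) w)))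
       + sg ((- 1) ^ (n + 1))
            (m_T br \<rho> T (u n) w (\<theta> (omit n Us) (v n))
             + r_T br \<rho> T (v n) w (\<theta> (omit n Us) (u n))))"

definition delta_T ::
    "('k::field \<Rightarrow> 'g::ab_group_add \<Rightarrow> 'g) \<Rightarrow> ('g \<Rightarrow> 'g \<Rightarrow> 'g \<Rightarrow> 'g) \<Rightarrow>
     ('k \<Rightarrow> 'v::ab_group_add \<Rightarrow> 'v) \<Rightarrow> ('g \<Rightarrow> 'g \<Rightarrow> 'v \<Rightarrow> 'v) \<Rightarrow> ('v \<Rightarrow> 'g) \<Rightarrow>
     ('g \<times> 'g \<Rightarrow>\<^sub>0 'k) set \<Rightarrow> 'v \<Rightarrow> 'g" where
  "delta_T sg br sv \<rho> T X v = T (rho2 sv \<rho> X v) - ad2 sg br X (T v)"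

text \<open>The following three definitions are meant for degrees \<open>k \<ge> 2\<close>, where the cochain space
  of degree \<open>k\<close> is \<open>leib_cochains sv sg (k - 1)\<close>; in degree 1 it is \<open>ext2 sg\<close>, which only
  enters through the coboundaries of degree 2.\<close>

definition cocycles ::
    "('k::field \<Rightarrow> 'g::ab_group_add \<Rightarrow> 'g) \<Rightarrow> ('g \<Rightarrow> 'g \<Rightarrow> 'g \<Rightarrow> 'g) \<Rightarrow>
     ('k \<Rightarrow> 'v::ab_group_add \<Rightarrow> 'v) \<Rightarrow> ('g \<Rightarrow> 'g \<Rightarrow> 'v \<Rightarrow> 'v) \<Rightarrow> ('v \<Rightarrow> 'g) \<Rightarrow> nat \<Rightarrow>
     ('v, 'g) cochain set" where
  "cocycles sg br sv \<rho> T k =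
     {\<theta> \<in> leib_cochains sv sg (k - 1). partial_T sg br \<rho> T (k - 1) \<theta> = (\<lambda>Us w. 0)}"

definition coboundaries ::
    "('k::field \<Rightarrow> 'g::ab_group_add \<Rightarrow> 'g) \<Rightarrow> ('g \<Rightarrow> 'g \<Rightarrow> 'g \<Rightarrow> 'g) \<Rightarrow>
     ('k \<Rightarrow> 'v::ab_group_add \<Rightarrow> 'v) \<Rightarrow> ('g \<Rightarrow> 'g \<Rightarrow> 'v \<Rightarrow> 'v) \<Rightarrow> ('v \<Rightarrow> 'g) \<Rightarrow> nat \<Rightarrow>
     ('v, 'g) cochain set" where
  "coboundaries sg br sv \<rho> T k =
     (if k = 2 then (\<lambda>X. hom_cochain (delta_T sg br sv \<rho> T X)) ` ext2 sg
      else partial_T sg br \<rho> T (k - 2) ` leib_cochains sv sg (k - 2))"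

definition cohomology ::
    "('k::field \<Rightarrow> 'g::ab_group_add \<Rightarrow> 'g) \<Rightarrow> ('g \<Rightarrow> 'g \<Rightarrow> 'g \<Rightarrow> 'g) \<Rightarrow>
     ('k \<Rightarrow> 'v::ab_group_add \<Rightarrow> 'v) \<Rightarrow> ('g \<Rightarrow> 'g \<Rightarrow> 'v \<Rightarrow> 'v) \<Rightarrow> ('v \<Rightarrow> 'g) \<Rightarrow> nat \<Rightarrow>
     ('v, 'g) cochain set set" where
  "cohomology sg br sv \<rho> T k =
     cocycles sg br sv \<rho> T k //
       {(\<theta>, \<theta>'). \<theta> \<in> cocycles sg br sv \<rho> T k \<and> \<theta>' \<in> cocycles sg br sv \<rho> T k \<and>
                 (\<lambda>Us w. \<theta> Us w - \<theta>' Us w) \<in> coboundaries sg br sv \<rho> T k}"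

section \<open>Formal deformations\<close>

text \<open>\<open>'a fps\<close> is used only as the set of power series with coefficients in the vector space \<open>'a\<close>.
  A series of maps \<open>\<Sum>\<^sub>i \<tau>\<^sub>i t\<^sup>i\<close> is given by its coefficient family, and \<open>ps_apply \<tau>\<close> is its extension
  to power series; \<open>ps_ext3\<close> extends a trilinear map to power series.\<close>

definition ps_apply :: "(nat \<Rightarrow> 'a \<Rightarrow> 'b::comm_monoid_add) \<Rightarrow> 'a fps \<Rightarrow> 'b fps" where
  "ps_apply \<tau> x = Abs_fps (\<lambda>n. \<Sum>i\<le>n. \<tau> i (fps_nth x (n - i)))"

definition ps_ext3 ::
    "('a \<Rightarrow> 'b \<Rightarrow> 'c \<Rightarrow> 'd::comm_monoid_add) \<Rightarrow> 'a fps \<Rightarrow> 'b fps \<Rightarrow> 'c fps \<Rightarrow> 'd fps" where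
  "ps_ext3 f x y z = Abs_fps (\<lambda>n. \<Sum>i\<le>n. \<Sum>j\<le>n - i.
     f (fps_nth x i) (fps_nth y j) (fps_nth z (n - i - j)))"

definition formal_deformation ::
    "('k::field \<Rightarrow> 'g::ab_group_add \<Rightarrow> 'g) \<Rightarrow> ('g \<Rightarrow> 'g \<Rightarrow> 'g \<Rightarrow> 'g) \<Rightarrow>
     ('k \<Rightarrow> 'v::ab_group_add \<Rightarrow> 'v) \<Rightarrow> ('g \<Rightarrow> 'g \<Rightarrow> 'v \<Rightarrow> 'v) \<Rightarrow> ('v \<Rightarrow> 'g) \<Rightarrow>
     (nat \<Rightarrow> 'v \<Rightarrow> 'g) \<Rightarrow> bool" where
  "formal_deformation sg br sv \<rho> T \<tau> \<longleftrightarrow>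
     (\<forall>i. Vector_Spaces.linear sv sg (\<tau> i)) \<and> \<tau> 0 = T \<and>
     (\<forall>u v w. let Tt = (\<lambda>x. ps_apply \<tau> (fps_const x)) in
        ps_ext3 br (Tt u) (Tt v) (Tt w) =
        ps_apply \<tau> (ps_ext3 \<rho> (Tt u) (Tt v) (fps_const w)))"

definition equivalent_deformations ::
    "('k::field \<Rightarrow> 'g::ab_group_add \<Rightarrow> 'g) \<Rightarrow> ('g \<Rightarrow> 'g \<Rightarrow> 'g \<Rightarrow> 'g) \<Rightarrow>
     ('k \<Rightarrow> 'v::ab_group_add \<Rightarrow> 'v) \<Rightarrow> ('g \<Rightarrow> 'g \<Rightarrow> 'v \<Rightarrow> 'v) \<Rightarrow>
     (nat \<Rightarrow> 'v \<Rightarrow> 'g) \<Rightarrow> (nat \<Rightarrow> 'v \<Rightarrow> 'g) \<Rightarrow> bool" where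
  "equivalent_deformations sg br sv \<rho> \<tau> \<tau>' \<longleftrightarrow>
     (\<exists>X \<phi> \<psi>. X \<in> ext2 sg \<and>
        \<phi> 0 = id \<and> \<phi> 1 = ad2 sg br X \<and> (\<forall>i\<ge>2. Vector_Spaces.linear sg sg (\<phi> i)) \<and>
        \<psi> 0 = id \<and> \<psi> 1 = rho2 sv \<rho> X \<and> (\<forall>i\<ge>2. Vector_Spaces.linear sv sv (\<psi> i)) \<and>
        (\<forall>x y z. ps_apply \<phi> (fps_const (br x y z)) =
           ps_ext3 br (ps_apply \<phi> (fps_const x)) (ps_apply \<phi> (fps_const y)) (ps_apply \<phi> (fps_const z))) \<and>
        (\<forall>x y u. ps_ext3 \<rho> (ps_apply \<phi> (fps_const x)) (ps_apply \<phi> (fps_const y)) (ps_apply \<psi> (fps_const u)) =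
           ps_apply \<psi> (fps_const (\<rho> x y u))) \<and>
        ps_apply \<tau> \<circ> ps_apply \<psi> = ps_apply \<phi> \<circ> ps_apply \<tau>')"

end

theory Submission
  imports Defs
begin

text \<open>
  Everything happens in the coefficient of \<open>t\<close>. In that degree, the equation
  \<open>T\<^sub>t \<circ> \<psi>\<^sub>t = \<phi>\<^sub>t \<circ> T\<^sub>t'\<close> reads
  \<open>T (\<rho>(X) v) + \<tau>\<^sub>1 v = [X, T v] + \<tau>\<^sub>1' v\<close>, that is, \<open>\<tau>\<^sub>1' - \<tau>\<^sub>1 = \<delta>(X)\<close>, and the
  right-hand side is a coboundary of degree 2. That the two infinitesimals have cohomology classes
  at all is read off the same coefficient of the deformation equation: it is the
  linearisation at \<open>T\<close> of the embedding tensor identity, and skew-symmetry of the bracket and of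
  \<open>\<rho>\<close> turns that into the vanishing of \<open>\<partial>\<^sub>T \<tau>\<^sub>1\<close> (lemmas \<open>partial_T_hom_cochain\<close> and \<open>infinitesimal_cocycle\<close>).
\<close>

lemma ps_apply_nth_0: "fps_nth (ps_apply \<tau> x) 0 = \<tau> 0 (fps_nth x 0)"
  by (simp add: ps_apply_def)

lemma ps_apply_nth_1:
  "fps_nth (ps_apply \<tau> x) 1 = \<tau> 0 (fps_nth x 1) + \<tau> 1 (fps_nth x 0)"
  by (simp add: ps_apply_def)

lemma ps_ext3_nth_0:
  "fps_nth (ps_ext3 f x y z) 0 = f (fps_nth x 0) (fps_nth y 0) (fps_nth z 0)"
  by (simp add: ps_ext3_def)

lemma ps_ext3_nth_1:
  "fps_nth (ps_ext3 f x y z) 1 =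
     f (fps_nth x 0) (fps_nth y 0) (fps_nth z 1) + f (fps_nth x 0) (fps_nth y 1) (fps_nth z 0)
       + f (fps_nth x 1) (fps_nth y 0) (fps_nth z 0)"
  by (simp add: ps_ext3_def)

context embedding_tensor
begin

lemma T_zero [simp]: "T 0 = 0"
  by (rule module_hom.zero[OF T_linear[folded module_hom_iff_linear]])

lemma T_add: "T (a + b) = T a + T b"
  by (rule module_hom.add[OF T_linear[folded module_hom_iff_linear]])

lemma T_minus: "T (- a) = - T a"
  by (rule module_hom.neg[OF T_linear[folded module_hom_iff_linear]])

lemma br_zero1 [simp]: "br 0 y z = 0"
  by (rule module_hom.zero[OF br_linear1[folded module_hom_iff_linear]])

lemma rho_zero1 [simp]: "\<rho> 0 y v = 0"
  by (rule module_hom.zero[OF rho_linear1[folded module_hom_iff_linear]])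

lemma rho_zero3 [simp]: "\<rho> x y 0 = 0"
  by (rule module_hom.zero[OF rho_gl[folded module_hom_iff_linear]])

lemma rho_skew: "\<rho> y x v = - \<rho> x y v"
proof -
  have "0 = \<rho> (x + y) (x + y) v"
    by (simp only: rho_alternating)
  also have "\<dots> = \<rho> x (x + y) v + \<rho> y (x + y) v"
    by (rule module_hom.add[OF rho_linear1[folded module_hom_iff_linear]])
  also have "\<dots> = \<rho> x y v + \<rho> y x v"
    by (simp add: module_hom.add[OF rho_linear2[folded module_hom_iff_linear]] rho_alternating)
  finally show ?thesis
    by (rule minus_unique[OF sym, THEN sym])
qed

text \<open>Characteristic 0 enters here: the bracket is only assumed skew-symmetric, while a map
  induced on the exterior square has to come from an alternating one.\<close>

lemma br_alternating: "br x x z = 0"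
proof -
  have "br x x z + br x x z = 0"
    using br_skew12[of x x z] by (simp add: eq_neg_iff_add_eq_0)
  then have "sg 2 (br x x z) = 0"
    using scale_left_distrib[of 1 1 "br x x z"] by simp
  then show ?thesis
    by simp
qed

lemma ad2_wedge: "ad2 sg br (wedge sg x y) z = br x y z"
  unfolding ad2_def by (rule ext2_lift_wedge[OF br_linear1 br_linear2 br_alternating])

lemma rho2_wedge: "rho2 sv \<rho> (wedge sg x y) v = \<rho> x y v"
  unfolding rho2_def by (rule ext2_lift_wedge[OF rho_linear1 rho_linear2 rho_alternating])

lemma delta_T_mem_coboundaries:
  assumes "X \<in> ext2 sg"
  shows "hom_cochain (delta_T sg br sv \<rho> T X) \<in> coboundaries sg br sv \<rho> T 2"
  using assms by (simp add: coboundaries_def)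

lemma zero_mem_coboundaries: "(\<lambda>Us w. 0) \<in> coboundaries sg br sv \<rho> T 2"
proof -
  have "wedge sg 0 0 \<in> ext2 sg"
    by (simp add: wedge_def ext2_def quotientI)
  moreover have "hom_cochain (delta_T sg br sv \<rho> T (wedge sg 0 0)) = (\<lambda>Us w. 0)"
    by (intro ext) (simp add: hom_cochain_def delta_T_def ad2_wedge rho2_wedge)
  ultimately show ?thesis
    using delta_T_mem_coboundaries by metis
qed

lemma hom_cochain_mem_leib_cochains:
  assumes "Vector_Spaces.linear sv sg \<theta>"
  shows "hom_cochain \<theta> \<in> leib_cochains sv sg 1"
  using assms by (auto simp: leib_cochains_def hom_cochain_def)

text \<open>The last term of the coboundary is \<open>m\<^sub>T(u, w)(\<theta> v) + r\<^sub>T(v, w)(\<theta> u)\<close>;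
  skew-symmetry moves \<open>\<theta> u\<close> into the first slot, so that the formula is the
  derivative of \<open>[Tu, Tv, Tw] - T (\<rho>(Tu, Tv) w)\<close> in the direction of \<open>\<theta>\<close>.\<close>

lemma partial_T_hom_cochain:
  "partial_T sg br \<rho> T 1 (hom_cochain \<theta>) [(u, v)] w =
     (br (\<theta> u) (T v) (T w) + br (T u) (\<theta> v) (T w) + br (T u) (T v) (\<theta> w))
       - (\<theta> (\<rho> (T u) (T v) w) + T (\<rho> (\<theta> u) (T v) w + \<rho> (T u) (\<theta> v) w))"
  using br_skew12[of "T v" "\<theta> u" "T w"] rho_skew[of "T v" "\<theta> u" w]
  by (simp add: partial_T_def hom_cochain_def omit_def put_def bracket_T_def l_T_def m_T_def r_T_def
      T_add T_minus algebra_simps)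

lemma infinitesimal_equation:
  assumes "formal_deformation sg br sv \<rho> T \<tau>"
  shows "br (\<tau> 1 u) (T v) (T w) + br (T u) (\<tau> 1 v) (T w) + br (T u) (T v) (\<tau> 1 w)
     = \<tau> 1 (\<rho> (T u) (T v) w) + T (\<rho> (\<tau> 1 u) (T v) w + \<rho> (T u) (\<tau> 1 v) w)"
proof -
  let ?T = "\<lambda>x. ps_apply \<tau> (fps_const x)"
  have T0: "\<tau> 0 = T"
    using assms by (simp add: formal_deformation_def)
  have "ps_ext3 br (?T u) (?T v) (?T w) = ps_apply \<tau> (ps_ext3 \<rho> (?T u) (?T v) (fps_const w))"
    using assms by (simp add: formal_deformation_def Let_def)
  from arg_cong[OF this, of "\<lambda>f. fps_nth f 1"] show ?thesis
    unfolding ps_apply_nth_1 ps_ext3_nth_1 ps_apply_nth_0 ps_ext3_nth_0 T0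
    by (simp add: add_ac)
qed

lemma infinitesimal_cocycle:
  assumes "formal_deformation sg br sv \<rho> T \<tau>"
  shows "hom_cochain (\<tau> 1) \<in> cocycles sg br sv \<rho> T 2"
proof -
  have "Vector_Spaces.linear sv sg (\<tau> 1)"
    using assms by (simp add: formal_deformation_def)
  then have "hom_cochain (\<tau> 1) \<in> leib_cochains sv sg 1"
    by (rule hom_cochain_mem_leib_cochains)
  moreover have "partial_T sg br \<rho> T 1 (hom_cochain (\<tau> 1)) Us w = 0" for Us w
  proof (cases "length Us = 1")
    case True
    then obtain u v where "Us = [(u, v)]"
      by (metis One_nat_def length_0_conv length_Suc_conv surj_pair)
    then show ?thesis
      using infinitesimal_equation[OF assms, of u v w]
      by (simp only: partial_T_hom_cochain diff_self)
  qed (simp add: partial_T_def)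
  ultimately show ?thesis
    by (auto simp: cocycles_def)
qed

lemma infinitesimals_differ_by_delta_T:
  assumes "\<tau> 0 = T" and "\<tau>' 0 = T"
    and "\<phi> 0 = id" and "\<phi> 1 = ad2 sg br X"
    and "\<psi> 0 = id" and "\<psi> 1 = rho2 sv \<rho> X"
    and "ps_apply \<tau> \<circ> ps_apply \<psi> = ps_apply \<phi> \<circ> ps_apply \<tau>'"
  shows "\<tau>' 1 v - \<tau> 1 v = delta_T sg br sv \<rho> T X v"
proof -
  have "ps_apply \<tau> (ps_apply \<psi> (fps_const v)) = ps_apply \<phi> (ps_apply \<tau>' (fps_const v))"
    using assms(7) by (metis comp_apply)
  from arg_cong[OF this, of "\<lambda>f. fps_nth f 1"]
  have "T (rho2 sv \<rho> X v) + \<tau> 1 v = \<tau>' 1 v + ad2 sg br X (T v)"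
    unfolding ps_apply_nth_1 ps_apply_nth_0 assms by simp
  then show ?thesis
    by (simp add: delta_T_def algebra_simps)
qed

end

theorem theorem5p5:
  fixes sg :: "'k::{alg_closed_field, field_char_0} \<Rightarrow> 'g::ab_group_add \<Rightarrow> 'g"
    and br :: "'g \<Rightarrow> 'g \<Rightarrow> 'g \<Rightarrow> 'g"
    and sv :: "'k \<Rightarrow> 'v::ab_group_add \<Rightarrow> 'v"
    and \<rho> :: "'g \<Rightarrow> 'g \<Rightarrow> 'v \<Rightarrow> 'v"
    and T :: "'v \<Rightarrow> 'g"
    and \<tau> \<tau>' :: "nat \<Rightarrow> 'v \<Rightarrow> 'g"
  assumes "embedding_tensor sg br sv \<rho> T"
    and "formal_deformation sg br sv \<rho> T \<tau>"
    and "formal_deformation sg br sv \<rho> T \<tau>'"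
    and "equivalent_deformations sg br sv \<rho> \<tau> \<tau>'"
  shows "\<exists>c \<in> cohomology sg br sv \<rho> T 2. hom_cochain (\<tau> 1) \<in> c \<and> hom_cochain (\<tau>' 1) \<in> c"
proof -
  interpret embedding_tensor sg br sv \<rho> T by fact
  let ?Z = "cocycles sg br sv \<rho> T 2"
  define R where "R = {(\<theta>, \<theta>'). \<theta> \<in> ?Z \<and> \<theta>' \<in> ?Z \<and>
              (\<lambda>Us w. \<theta> Us w - \<theta>' Us w) \<in> coboundaries sg br sv \<rho> T 2}"
  have "hom_cochain (\<tau> 1) \<in> ?Z" and Z': "hom_cochain (\<tau>' 1) \<in> ?Z"
    using assms(2,3)[THEN infinitesimal_cocycle] by this
  obtain X \<phi> \<psi> where "X \<in> ext2 sg" and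
    eq: "\<phi> 0 = id" "\<phi> 1 = ad2 sg br X" "\<psi> 0 = id" "\<psi> 1 = rho2 sv \<rho> X"
      "ps_apply \<tau> \<circ> ps_apply \<psi> = ps_apply \<phi> \<circ> ps_apply \<tau>'"
    using assms(4) unfolding equivalent_deformations_def by blast
  have "\<tau> 0 = T" "\<tau>' 0 = T"
    using assms(2,3) by (simp_all add: formal_deformation_def)
  then have "\<tau>' 1 v - \<tau> 1 v = delta_T sg br sv \<rho> T X v" for v
    using eq by (rule infinitesimals_differ_by_delta_T)
  then have "(\<lambda>Us w. hom_cochain (\<tau>' 1) Us w - hom_cochain (\<tau> 1) Us w)
      = hom_cochain (delta_T sg br sv \<rho> T X)"
    by (intro ext) (simp add: hom_cochain_def)
  with \<open>X \<in> ext2 sg\<close> have "(hom_cochain (\<tau>' 1), hom_cochain (\<tau> 1)) \<in> R"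
    using \<open>hom_cochain (\<tau> 1) \<in> ?Z\<close> Z' by (simp add: R_def delta_T_mem_coboundaries)
  moreover have "(hom_cochain (\<tau>' 1), hom_cochain (\<tau>' 1)) \<in> R"
    using Z' by (simp add: R_def zero_mem_coboundaries)
  \<comment> \<open>The class is based at \<open>\<tau>\<^sub>1'\<close>, so that the difference needed is \<open>\<delta>(X)\<close> itself and not its
    negative.\<close>
  moreover have "R `` {hom_cochain (\<tau>' 1)} \<in> cohomology sg br sv \<rho> T 2"
    unfolding cohomology_def R_def using Z' by (rule quotientI)
  ultimately show ?thesis
    by blast
qed

end
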